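(* Let $X$ be an arbitrary set with at least three elements, let $\mathcal{P}=\{X_i \mid i\in I\}$ be a partition of $X$, and let $f\in\Gamma(X,\mathcal{P})$. Then $f$ is an idempotent if and only if for each $i\in I\chi^{(f)}$ the block map $f_i\in B(f,I)$ is the identity map (on $X_i$).
   Context: Maps are written on the right and composed from left to right: $xf$ is the image of $x$ under $f$, $x(fg)=(xf)g$, and $Af$ is the image of a subset $A$ under $f$. A partition of $X$ is a collection of nonempty pairwise disjoint subsets (blocks) with union $X$; distinct indices correspond to distinct blocks. $\mathcal{T}_X$ is the semigroup of all maps $X\to X$ under composition. $\Gamma(X,\mathcal{P})=\{f\in\mathcal{T}_X \mid (\forall X_i\in\mathcal{P})(\exists X_j\in\mathcal{P})\; X_if=X_j\}$. For $f\in\Gamma(X,\mathcal{P})$, the character $\chi^{(f)}\colon I\to I$ is defined by $i\chi^{(f)}=j$ whenever $X_if\subseteq X_j$ (equivalently here, $X_if=X_j$); $I\chi^{(f)}$ is its image. A block map is a map whose domain and codomain are blocks of $\mathcal{P}$. For each $i\in I$, $f_i$ is the block map with domain $X_i$ and codomain $X_{i\chi^{(f)}}$ induced by $f$, i.e. $xf_i=xf$ for $x\in X_i$; $B(f,I)=\{f_i \mid i\in I\}$ is the indexed family of these. An element $a$ of a semigroup is an idempotent if $a^2=a$. *)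

theory Defs
  imports "HOL-Algebra.Group" "HOL-Library.FuncSet" "HOL-Library.Disjoint_Sets"
begin

text \<open>
  Maps in the source act on the right and are composed from left to right, so its product
  \<open>f g\<close> is the map \<open>x \<mapsto> g (f x)\<close>. A map \<open>X \<rightarrow> Y\<close> is represented by the element of
  \<open>X \<rightarrow>\<^sub>E Y\<close> with the same values on \<open>X\<close>.
\<close>

definition full_transformations :: "'a set \<Rightarrow> ('a \<Rightarrow> 'a) monoid" where
  "full_transformations X =
     \<lparr>carrier = X \<rightarrow>\<^sub>E X, mult = (\<lambda>f g. compose X g f), one = (\<lambda>x\<in>X. x)\<rparr>"

lemma monoid_full_transformations: "monoid (full_transformations X)"
  by (rule monoidI)
     (auto simp: full_transformations_def compose_def fun_eq_iff PiE_iff extensional_def)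

definition idempotent_in :: "('a, 'b) monoid_scheme \<Rightarrow> 'a \<Rightarrow> bool" where
  "idempotent_in S a \<longleftrightarrow> a \<in> carrier S \<and> a \<otimes>\<^bsub>S\<^esub> a = a"

definition Gamma :: "'a set \<Rightarrow> 'a set set \<Rightarrow> ('a \<Rightarrow> 'a) set" where
  "Gamma X \<P> = {f \<in> carrier (full_transformations X). \<forall>A\<in>\<P>. \<exists>B\<in>\<P>. f ` A = B}"

text \<open>
  The family \<open>P\<close> indexes the blocks by \<open>I\<close>; injectivity expresses that distinct indices
  correspond to distinct blocks.
\<close>

definition indexed_partition :: "'a set \<Rightarrow> 'i set \<Rightarrow> ('i \<Rightarrow> 'a set) \<Rightarrow> bool" where
  "indexed_partition X I P \<longleftrightarrow> partition_on X (P ` I) \<and> inj_on P I"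

definition character :: "'i set \<Rightarrow> ('i \<Rightarrow> 'a set) \<Rightarrow> ('a \<Rightarrow> 'a) \<Rightarrow> 'i \<Rightarrow> 'i" where
  "character I P f = (\<lambda>i\<in>I. THE j. j \<in> I \<and> f ` P i \<subseteq> P j)"

lemma character_ex1:
  assumes P: "indexed_partition X I P" and f: "f \<in> Gamma X (P ` I)" and i: "i \<in> I"
  shows "\<exists>!j. j \<in> I \<and> f ` P i \<subseteq> P j"
proof -
  obtain j where j: "j \<in> I" "f ` P i = P j"
    using f i by (auto simp: Gamma_def)
  have ne: "P j \<noteq> {}"
    using P j by (auto simp: indexed_partition_def partition_on_def)
  have "k = j" if k: "k \<in> I" "f ` P i \<subseteq> P k" for k
  proof (rule ccontr)
    assume "k \<noteq> j"
    then have "P k \<noteq> P j"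
      using P j k by (auto simp: indexed_partition_def inj_on_def)
    then have "P k \<inter> P j = {}"
      using P j k by (auto simp: indexed_partition_def partition_on_def disjoint_def)
    with j k ne show False by auto
  qed
  with j show ?thesis by (intro ex1I[of _ j]) auto
qed

lemma character_image:
  assumes P: "indexed_partition X I P" and f: "f \<in> Gamma X (P ` I)" and i: "i \<in> I"
  shows "character I P f i \<in> I" and "f ` P i = P (character I P f i)"
proof -
  obtain j where j: "j \<in> I" "f ` P i = P j"
    using f i by (auto simp: Gamma_def)
  have "character I P f i = j"
    using the1_equality[OF character_ex1[OF assms]] i j by (auto simp: character_def)
  with j show "character I P f i \<in> I" and "f ` P i = P (character I P f i)" by auto
qed

text \<open>
  Domain and codomain are part of a block map, so two block maps are equal only if their
  codomains agree as well.
\<close>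

record 'a block_map =
  bm_dom :: "'a set"
  bm_cod :: "'a set"
  bm_fun :: "'a \<Rightarrow> 'a"

definition block_maps :: "'a set set \<Rightarrow> 'a block_map set" where
  "block_maps \<P> = {b. bm_dom b \<in> \<P> \<and> bm_cod b \<in> \<P> \<and> bm_fun b \<in> bm_dom b \<rightarrow>\<^sub>E bm_cod b}"

definition identity_block_map :: "'a set \<Rightarrow> 'a block_map" where
  "identity_block_map A = \<lparr>bm_dom = A, bm_cod = A, bm_fun = (\<lambda>x\<in>A. x)\<rparr>"

definition induced_block_maps ::
    "('a \<Rightarrow> 'a) \<Rightarrow> 'i set \<Rightarrow> ('i \<Rightarrow> 'a set) \<Rightarrow> 'i \<Rightarrow> 'a block_map" where
  "induced_block_maps f I P =
     (\<lambda>i\<in>I. \<lparr>bm_dom = P i, bm_cod = P (character I P f i), bm_fun = restrict f (P i)\<rparr>)"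

lemma induced_block_maps_in_block_maps:
  assumes "indexed_partition X I P" and "f \<in> Gamma X (P ` I)"
  shows "induced_block_maps f I P \<in> I \<rightarrow>\<^sub>E block_maps (P ` I)"
  using character_image[OF assms] by (fastforce simp: induced_block_maps_def block_maps_def)

end

theory Submission imports Defs begin

text \<open>
  A map is idempotent exactly when it fixes every point of its image. Since \<open>f\<close> sends each
  block onto a block, its image is the union of the blocks \<open>P j\<close> with \<open>j\<close> in the image of the
  character (\<open>image_eq_Union_character\<close>), so idempotence can be tested block by block over
  these indices. On a single block, fixing all points is the same as inducing the identity
  block map (\<open>induced_block_map_eq_identity_iff\<close>); the codomain takes care of itself, because
  the block onto which \<open>f\<close> maps \<open>P i\<close> determines the codomain of the induced map.
\<close>

lemma idempotent_in_full_transformations_iff: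
  assumes "f \<in> X \<rightarrow>\<^sub>E X"
  shows "idempotent_in (full_transformations X) f \<longleftrightarrow> (\<forall>y \<in> f ` X. f y = y)"
proof -
  \<comment> \<open>Both sides of \<open>compose X f f = f\<close> are extensional, so only points of \<open>X\<close> matter.\<close>
  have "compose X f f = f \<longleftrightarrow> (\<forall>x\<in>X. f (f x) = f x)"
    using assms by (auto simp: compose_def fun_eq_iff PiE_iff extensional_def)
  with assms show ?thesis
    by (simp add: idempotent_in_def full_transformations_def)
qed

lemma image_eq_Union_character:
  assumes P: "indexed_partition X I P" and f: "f \<in> Gamma X (P ` I)"
  shows "f ` X = (\<Union>j \<in> character I P f ` I. P j)"
proof -
  have "X = (\<Union>i\<in>I. P i)"
    using P by (simp add: indexed_partition_def partition_on_def)
  then have "f ` X = (\<Union>i\<in>I. f ` P i)"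
    by (simp add: image_UN)
  also have "\<dots> = (\<Union>i\<in>I. P (character I P f i))"
    using character_image(2)[OF P f] by simp
  finally show ?thesis by simp
qed

text \<open>
  If \<open>f\<close> fixes the block \<open>P i\<close> pointwise, then the block onto which it maps \<open>P i\<close> is \<open>P i\<close>
  itself, so the induced map and the identity agree in their codomains as well as in their
  values.
\<close>

lemma induced_block_map_eq_identity_iff:
  assumes P: "indexed_partition X I P" and f: "f \<in> Gamma X (P ` I)" and i: "i \<in> I"
  shows "induced_block_maps f I P i = identity_block_map (P i) \<longleftrightarrow> (\<forall>x \<in> P i. f x = x)"
proof
  assume "induced_block_maps f I P i = identity_block_map (P i)"
  then have "restrict f (P i) = (\<lambda>x\<in>P i. x)"
    using i by (simp add: induced_block_maps_def identity_block_map_def)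
  then show "\<forall>x \<in> P i. f x = x"
    by (metis restrict_apply')
next
  assume fixed: "\<forall>x \<in> P i. f x = x"
  then have "P (character I P f i) = P i"
    using character_image(2)[OF P f i] by simp
  moreover have "restrict f (P i) = (\<lambda>x\<in>P i. x)"
    using fixed by (simp add: restrict_def fun_eq_iff)
  ultimately show "induced_block_maps f I P i = identity_block_map (P i)"
    using i by (simp add: induced_block_maps_def identity_block_map_def)
qed

theorem theorem5p9:
  fixes X :: "'a set" and I :: "'i set" and P :: "'i \<Rightarrow> 'a set" and f :: "'a \<Rightarrow> 'a"
  assumes "infinite X \<or> 3 \<le> card X"
    and "indexed_partition X I P"
    and "f \<in> Gamma X (P ` I)"
  shows "idempotent_in (full_transformations X) f \<longleftrightarrow>
    (\<forall>i \<in> character I P f ` I. induced_block_maps f I P i = identity_block_map (P i))"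
proof -
  have "f \<in> X \<rightarrow>\<^sub>E X"
    using assms(3) by (simp add: Gamma_def full_transformations_def)
  then have "idempotent_in (full_transformations X) f \<longleftrightarrow> (\<forall>y \<in> f ` X. f y = y)"
    by (rule idempotent_in_full_transformations_iff)
  also have "\<dots> \<longleftrightarrow> (\<forall>i \<in> character I P f ` I. \<forall>y \<in> P i. f y = y)"
    unfolding image_eq_Union_character[OF assms(2,3)] by blast
  also have "\<dots> \<longleftrightarrow>
      (\<forall>i \<in> character I P f ` I. induced_block_maps f I P i = identity_block_map (P i))"
    using induced_block_map_eq_identity_iff[OF assms(2,3)] character_image(1)[OF assms(2,3)]
    by auto
  finally show ?thesis .
qed

end
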